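(* Let $X$ be a topological space. The following are equivalent: (1) $X$ is hyperconnected. (2) Every non-empty $\mathcal{AB}$-set in $X$ is dense in $X$.
   Context: For a subset $A$ of a topological space $X$, $\mathrm{Int}\,A$ denotes the interior and $\overline{A}$ the closure of $A$ in $X$. $A$ is semi-open if $A \subseteq \overline{\mathrm{Int}\,A}$; semi-closed if its complement is semi-open; semi-regular if it is both semi-open and semi-closed. $A$ is an $\mathcal{AB}$-set if $A = U \cap V$ with $U$ open and $V$ semi-regular. A space $X$ is hyperconnected if every non-empty open subset of $X$ is dense in $X$. No separation axioms are assumed. *)

theory Defs
  imports "HOL-Analysis.Analysis"
begin

definition semi_open_in :: "'a topology \<Rightarrow> 'a set \<Rightarrow> bool" where
  "semi_open_in X A \<longleftrightarrow> A \<subseteq> topspace X \<and> A \<subseteq> X closure_of (X interior_of A)"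

definition semi_closed_in :: "'a topology \<Rightarrow> 'a set \<Rightarrow> bool" where
  "semi_closed_in X A \<longleftrightarrow> A \<subseteq> topspace X \<and> semi_open_in X (topspace X - A)"

definition semi_regular_in :: "'a topology \<Rightarrow> 'a set \<Rightarrow> bool" where
  "semi_regular_in X A \<longleftrightarrow> semi_open_in X A \<and> semi_closed_in X A"

definition AB_set_in :: "'a topology \<Rightarrow> 'a set \<Rightarrow> bool" where
  "AB_set_in X A \<longleftrightarrow> (\<exists>U V. openin X U \<and> semi_regular_in X V \<and> A = U \<inter> V)"

definition dense_in :: "'a topology \<Rightarrow> 'a set \<Rightarrow> bool" where
  "dense_in X A \<longleftrightarrow> A \<subseteq> topspace X \<and> X closure_of A = topspace X"

text \<open>The empty space counts as hyperconnected.\<close>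

definition hyperconnected_space :: "'a topology \<Rightarrow> bool" where
  "hyperconnected_space X \<longleftrightarrow> (\<forall>U. openin X U \<and> U \<noteq> {} \<longrightarrow> dense_in X U)"

end

theory Submission
  imports Defs
begin

text \<open>The open sets and the AB-sets are cofinal in each other from below: every open set is an
  AB-set (\<open>openin_imp_AB_set_in\<close>), and every non-empty AB-set contains a non-empty open
  set (\<open>AB_set_in_contains_open\<close>). Since density passes to larger sets, it holds for
  all non-empty members of one class exactly when it does for the other.\<close>

lemma dense_in_mono:
  assumes "dense_in X A" "A \<subseteq> B" "B \<subseteq> topspace X"
  shows "dense_in X B"
  using assms closure_of_mono[of A B X] closure_of_subset_topspace[of X B]
  unfolding dense_in_def by blast

text \<open>The whole space is its own interior and its complement is empty; it serves as the factor
  \<open>V\<close> that makes any open \<open>U\<close> an AB-set.\<close>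

lemma semi_regular_in_topspace: "semi_regular_in X (topspace X)"
  by (simp add: semi_regular_in_def semi_closed_in_def semi_open_in_def)

lemma openin_imp_AB_set_in:
  assumes "openin X U"
  shows "AB_set_in X U"
  using assms semi_regular_in_topspace[of X] openin_subset[OF assms]
  unfolding AB_set_in_def by blast

text \<open>A point of \<open>U \<inter> V\<close> lies in the closure of the interior of
  \<open>V\<close> by semi-openness, so its open neighbourhood \<open>U\<close> meets that interior;
  the overlap is the required \<open>W\<close>.\<close>

lemma AB_set_in_contains_open:
  assumes "AB_set_in X A" "A \<noteq> {}"
  obtains W where "openin X W" "W \<noteq> {}" "W \<subseteq> A"
proof -
  obtain U V where U: "openin X U" and V: "V \<subseteq> X closure_of (X interior_of V)"
    and A: "A = U \<inter> V"
    using assms unfolding AB_set_in_def semi_regular_in_def semi_open_in_def by blast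
  have "U \<inter> X closure_of (X interior_of V) \<noteq> {}"
    using A V assms(2) by blast
  then have "U \<inter> X interior_of V \<noteq> {}"
    using openin_Int_closure_of_eq_empty[OF U] by blast
  moreover have "openin X (U \<inter> X interior_of V)"
    using U by (intro openin_Int openin_interior_of)
  moreover have "U \<inter> X interior_of V \<subseteq> A"
    using A interior_of_subset[of X V] by blast
  ultimately show thesis
    using that by blast
qed

theorem theorem3p6:
  fixes X :: "'a topology"
  shows "hyperconnected_space X \<longleftrightarrow> (\<forall>A. AB_set_in X A \<and> A \<noteq> {} \<longrightarrow> dense_in X A)"
proof
  assume hyp: "hyperconnected_space X"
  show "\<forall>A. AB_set_in X A \<and> A \<noteq> {} \<longrightarrow> dense_in X A"
  proof (intro allI impI, elim conjE)
    fix A assume A: "AB_set_in X A" "A \<noteq> {}"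
    then obtain W where W: "openin X W" "W \<noteq> {}" "W \<subseteq> A"
      by (rule AB_set_in_contains_open)
    \<comment> \<open>\<open>dense_in\<close> also asks for containment in the carrier, which
      \<open>A\<close> inherits from its open factor.\<close>
    have "A \<subseteq> topspace X"
      using A(1) openin_subset unfolding AB_set_in_def by blast
    with W hyp show "dense_in X A"
      unfolding hyperconnected_space_def by (blast intro: dense_in_mono)
  qed
next
  assume "\<forall>A. AB_set_in X A \<and> A \<noteq> {} \<longrightarrow> dense_in X A"
  then show "hyperconnected_space X"
    unfolding hyperconnected_space_def by (blast intro: openin_imp_AB_set_in)
qed

end
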